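(* Let $G$ be an $n$-dimensional torus, let $\Gamma$ be a finite $d$-valent graph with vertex set $V$ equipped with a GKM action of $G$, and let $f\in K_G(\Gamma)$, $f_p=e^{2\pi i\alpha_p}$, be symplectic. If $\alpha\in\mathbb Z_G^*$ is a weight of $Q(f)$, then $\alpha$ is in the convex hull of $\{\alpha_p : p\in V\}$ in $\mathfrak g^*$.
   Context: Torus notation. $\mathfrak g$ is the Lie algebra of $G$, $\mathbb Z_G=\ker(\exp:\mathfrak g\to G)$, and $\mathbb Z_G^*=\{\alpha\in\mathfrak g^*:\alpha(v)\in\mathbb Z\text{ for all }v\in\mathbb Z_G\}$ is the weight lattice. For $\alpha\in\mathbb Z_G^*$, $e^{2\pi i\alpha}:G\to S^1$ is the character $\exp(x)\mapsto e^{2\pi i\alpha(x)}$. For a compact commutative Lie group $H$, $R(H)$ is the representation ring, identified with the character ring: all finite sums $\sum m_k\chi_k$ with $m_k\in\mathbb Z$ and $\chi_k:H\to S^1$ characters. Graph and action. $E$ is the set of oriented edges of $\Gamma$ (each unoriented edge gives two oriented edges). For $e\in E$, $i(e)$ and $t(e)$ are its initial and terminal vertices and $\bar e$ is $e$ with reversed orientation. $d$-valent means each vertex $p$ has exactly $d$ oriented edges $e$ with $i(e)=p$. An action of $G$ on $\Gamma$ assigns to each $e\in E$ a one-dimensional representation $\varrho_e$ with character $\chi_e=e^{2\pi i\alpha_e}$, $\alpha_e\in\mathbb Z_G^*$, and to each $p\in V$ a $d$-dimensional representation $\tau_p$, such that, with $G_e=\ker\chi_e$: $\tau_p\simeq\bigoplus_{i(e)=p}\varrho_e$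 for all $p$; $\varrho_{\bar e}\simeq\varrho_e^*$ (so $\alpha_{\bar e}=-\alpha_e$); and $\tau_{i(e)}|_{G_e}\simeq\tau_{t(e)}|_{G_e}$ for all $e$. The action is GKM if for any two distinct oriented edges $e_1\ne e_2$ with $i(e_1)=i(e_2)$ the weights $\alpha_{e_1},\alpha_{e_2}$ are linearly independent. It is also assumed that $\alpha_e\neq0$ for all $e$ (automatic if $d\ge2$). $K_G(\Gamma)$ is the set of functions $f:V\to R(G)$, $p\mapsto f_p$, with $r_e f_{i(e)}=r_e f_{t(e)}$ for every edge $e$, where $r_e:R(G)\to R(G_e)$ is restriction. Symplectic. Suppose $f\in K_G(\Gamma)$ has the form $f_p=e^{2\pi i\alpha_p}$ with $\alpha_p\in\mathbb Z_G^*$. Then for every oriented edge $e$ from $p$ to $q$ one has $\alpha_q-\alpha_p=m_e\alpha_e$ for some integer $m_e$; $f$ is symplectic if $m_e>0$ for all $e$. $Q(f)$ is the virtual representation of $G$ with character $\chi(f)=\sum_{p\in V}f_p\prod_{i(e)=p}(1-e^{2\pi i\alpha_e})^{-1}$, which is known to lie in $R(G)$. Writing $\chi(f)=\sum_\alpha m_\alpha e^{2\pi i\alpha}$, the multiplicity of $\alpha$ in $Q(f)$ is $m_\alpha$, and $\alpha$ is a weight of $Q(f)$ if $m_\alpha\neq0$. *)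

theory Defs
  imports
    "HOL-Analysis.Analysis"
    "Jordan_Normal_Form.Matrix"
    "Graph_Theory.Bidirected_Digraph"
begin

section \<open>Tori, weights and characters\<close>

text \<open>
  A torus is given together with its Lie algebra and exponential map. The group \<open>G\<close> is the type
  \<open>'g\<close>, written additively; \<open>\<gg>\<close> is the type \<open>'a\<close>. A Hausdorff topological group that is the image of
  a continuous homomorphism from an \<open>n\<close>-dimensional real vector space whose kernel is a full lattice
  is, by compactness, topologically isomorphic to \<open>\<gg>/\<int>\<^sub>G\<close>, and every torus arises in this way.
  As \<open>'a\<close> is finite-dimensional, \<open>'a \<Rightarrow>\<^sub>L real\<close> is the full dual space \<open>\<gg>*\<close>.
\<close>

definition exp_kernel :: "('a::real_normed_vector \<Rightarrow> 'g::ab_group_add) \<Rightarrow> 'a set" where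
  "exp_kernel ex = {x. ex x = 0}"

locale torus =
  fixes n :: nat
    and ex :: "'a::real_normed_vector \<Rightarrow> 'g::{topological_ab_group_add, t2_space}"
  assumes continuous_ex: "continuous_on UNIV ex"
    and ex_add: "ex (x + y) = ex x + ex y"
    and surj_ex: "surj ex"
    and lattice: "\<exists>B. finite B \<and> card B = n \<and> independent B \<and> span B = UNIV \<and>
      exp_kernel ex = {\<Sum>b\<in>B. real_of_int (c b) *\<^sub>R b |c :: 'a \<Rightarrow> int. True}"

definition weight_lattice ::
    "('a::real_normed_vector \<Rightarrow> 'g::ab_group_add) \<Rightarrow> ('a \<Rightarrow>\<^sub>L real) set" where
  "weight_lattice ex = {\<alpha>. \<forall>v\<in>exp_kernel ex. blinfun_apply \<alpha> v \<in> \<int>}"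

text \<open>
  The character \<open>ex x \<mapsto> e\<^bsup>2\<pi>i\<alpha>(x)\<^esup>\<close>. For \<open>\<alpha>\<close> in the weight lattice the value does not depend on the
  preimage chosen by \<open>inv_into\<close>.
\<close>

definition weight_char ::
    "('a::real_normed_vector \<Rightarrow> 'g) \<Rightarrow> ('a \<Rightarrow>\<^sub>L real) \<Rightarrow> 'g \<Rightarrow> complex" where
  "weight_char ex \<alpha> g = cis (2 * pi * blinfun_apply \<alpha> (inv_into UNIV ex g))"

definition characters :: "'g::{topological_space, group_add} set \<Rightarrow> ('g \<Rightarrow> complex) set" where
  "characters H = {c. continuous_on H c \<and> (\<forall>g\<in>H. cmod (c g) = 1) \<and>
     (\<forall>g\<in>H. \<forall>h\<in>H. c (g + h) = c g * c h)}"

text \<open>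
  \<open>R(H)\<close> for a closed subgroup \<open>H\<close>, as a ring of functions on \<open>H\<close> (set to \<open>undefined\<close> outside \<open>H\<close>).
\<close>

definition rep_ring :: "'g::{topological_space, group_add} set \<Rightarrow> ('g \<Rightarrow> complex) set" where
  "rep_ring H = {restrict (\<lambda>g. \<Sum>c\<in>C. of_int (m c) * c g) H |C (m :: ('g \<Rightarrow> complex) \<Rightarrow> int).
     finite C \<and> C \<subseteq> characters H}"

section \<open>Representations\<close>

text \<open>
  Continuous complex representations of a subgroup \<open>H\<close> of dimension \<open>d\<close>, with respect to a basis
  of the representation space.
\<close>

definition is_representation ::
    "'g::{topological_space, group_add} set \<Rightarrow> nat \<Rightarrow> ('g \<Rightarrow> complex mat) \<Rightarrow> bool" where
  "is_representation H d \<rho> \<longleftrightarrow>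
     (\<forall>g\<in>H. \<rho> g \<in> carrier_mat d d) \<and> \<rho> 0 = 1\<^sub>m d \<and>
     (\<forall>g\<in>H. \<forall>h\<in>H. \<rho> (g + h) = \<rho> g * \<rho> h) \<and>
     (\<forall>i<d. \<forall>j<d. continuous_on H (\<lambda>g. \<rho> g $$ (i, j)))"

text \<open>
  Isomorphism of the restrictions to \<open>H\<close> of two \<open>d\<close>-dimensional representations.
\<close>

definition rep_iso ::
    "'g set \<Rightarrow> nat \<Rightarrow> ('g \<Rightarrow> complex mat) \<Rightarrow> ('g \<Rightarrow> complex mat) \<Rightarrow> bool" where
  "rep_iso H d \<rho> \<sigma> \<longleftrightarrow>
     (\<exists>P\<in>carrier_mat d d. invertible_mat P \<and> (\<forall>g\<in>H. P * \<rho> g = \<sigma> g * P))"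

definition rep_character :: "('g \<Rightarrow> complex mat) \<Rightarrow> 'g \<Rightarrow> complex" where
  "rep_character \<rho> g = (\<Sum>i<dim_row (\<rho> g). \<rho> g $$ (i, i))"

definition dual_rep :: "('g::group_add \<Rightarrow> complex mat) \<Rightarrow> 'g \<Rightarrow> complex mat" where
  "dual_rep \<rho> g = transpose_mat (\<rho> (- g))"

definition direct_sum_rep :: "('g \<Rightarrow> complex mat) list \<Rightarrow> 'g \<Rightarrow> complex mat" where
  "direct_sum_rep \<rho>s g = diag_block_mat (map (\<lambda>\<rho>. \<rho> g) \<rho>s)"

section \<open>GKM actions on graphs\<close>

text \<open>
  The arcs of \<open>\<Gamma>\<close> are the oriented edges, with \<open>i(e) = tail \<Gamma> e\<close> and \<open>t(e) = head \<Gamma> e\<close>; \<open>arev\<close> is the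
  orientation reversal, which \<open>bidirected_digraph\<close> makes a fixed-point-free involution on the arcs.
\<close>

definition edge_kernel ::
    "('a::real_normed_vector \<Rightarrow> 'g) \<Rightarrow> ('a \<Rightarrow>\<^sub>L real) \<Rightarrow> 'g set" where
  "edge_kernel ex \<alpha> = {g. weight_char ex \<alpha> g = 1}"

locale valent_graph = fin_digraph \<Gamma> + bidirected_digraph \<Gamma> arev
  for \<Gamma> :: "('v, 'e) pre_digraph" and arev :: "'e \<Rightarrow> 'e" +
  fixes d :: nat
  assumes valent: "p \<in> verts \<Gamma> \<Longrightarrow> out_degree \<Gamma> p = d"

locale graph_action = torus n ex + valent_graph \<Gamma> arev d
  for n :: nat
    and ex :: "'a::real_normed_vector \<Rightarrow> 'g::{topological_ab_group_add, t2_space}"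
    and \<Gamma> :: "('v, 'e) pre_digraph" and arev :: "'e \<Rightarrow> 'e" and d :: nat +
  fixes \<rho> :: "'e \<Rightarrow> 'g \<Rightarrow> complex mat"
    and \<alpha> :: "'e \<Rightarrow> 'a \<Rightarrow>\<^sub>L real"
    and \<tau> :: "'v \<Rightarrow> 'g \<Rightarrow> complex mat"
  assumes edge_rep: "e \<in> arcs \<Gamma> \<Longrightarrow> is_representation UNIV 1 (\<rho> e)"
    and edge_weight: "e \<in> arcs \<Gamma> \<Longrightarrow> \<alpha> e \<in> weight_lattice ex"
    and edge_character: "e \<in> arcs \<Gamma> \<Longrightarrow> rep_character (\<rho> e) = weight_char ex (\<alpha> e)"
    and vertex_rep: "p \<in> verts \<Gamma> \<Longrightarrow> is_representation UNIV d (\<tau> p)"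
    and vertex_sum: "p \<in> verts \<Gamma> \<Longrightarrow>
      \<exists>es. distinct es \<and> set es = out_arcs \<Gamma> p \<and>
        rep_iso UNIV d (\<tau> p) (direct_sum_rep (map \<rho> es))"
    and edge_dual: "e \<in> arcs \<Gamma> \<Longrightarrow> rep_iso UNIV 1 (\<rho> (arev e)) (dual_rep (\<rho> e))"
    and edge_compat: "e \<in> arcs \<Gamma> \<Longrightarrow>
      rep_iso (edge_kernel ex (\<alpha> e)) d (\<tau> (tail \<Gamma> e)) (\<tau> (head \<Gamma> e))"

text \<open>
  The inequality in \<open>weights_independent\<close> is needed because \<open>independent {\<beta>, \<beta>}\<close> holds for
  every nonzero \<open>\<beta>\<close>.
\<close>

locale gkm_action = graph_action n ex \<Gamma> arev d \<rho> \<alpha> \<tau>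
  for n :: nat
    and ex :: "'a::real_normed_vector \<Rightarrow> 'g::{topological_ab_group_add, t2_space}"
    and \<Gamma> :: "('v, 'e) pre_digraph" and arev :: "'e \<Rightarrow> 'e" and d :: nat
    and \<rho> :: "'e \<Rightarrow> 'g \<Rightarrow> complex mat"
    and \<alpha> :: "'e \<Rightarrow> 'a \<Rightarrow>\<^sub>L real"
    and \<tau> :: "'v \<Rightarrow> 'g \<Rightarrow> complex mat" +
  assumes weights_independent:
      "\<lbrakk>e1 \<in> arcs \<Gamma>; e2 \<in> arcs \<Gamma>; e1 \<noteq> e2; tail \<Gamma> e1 = tail \<Gamma> e2\<rbrakk> \<Longrightarrow>
        \<alpha> e1 \<noteq> \<alpha> e2 \<and> independent {\<alpha> e1, \<alpha> e2}"
    and weight_nonzero: "e \<in> arcs \<Gamma> \<Longrightarrow> \<alpha> e \<noteq> 0"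

definition K_ring ::
    "('a::real_normed_vector \<Rightarrow> 'g::{topological_space, group_add}) \<Rightarrow> ('v, 'e) pre_digraph \<Rightarrow>
     ('e \<Rightarrow> 'a \<Rightarrow>\<^sub>L real) \<Rightarrow> ('v \<Rightarrow> 'g \<Rightarrow> complex) set" where
  "K_ring ex \<Gamma> \<alpha> = {f. (\<forall>p\<in>verts \<Gamma>. f p \<in> rep_ring UNIV) \<and>
     (\<forall>e\<in>arcs \<Gamma>. restrict (f (tail \<Gamma> e)) (edge_kernel ex (\<alpha> e)) =
                 restrict (f (head \<Gamma> e)) (edge_kernel ex (\<alpha> e)))}"

text \<open>
  Here \<open>a p\<close> are the exponents \<open>\<alpha>\<^sub>p\<close> of \<open>f\<close>, i.e. \<open>f p = weight_char ex (a p)\<close>.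
\<close>

definition symplectic ::
    "('v, 'e) pre_digraph \<Rightarrow> ('e \<Rightarrow> 'a::real_normed_vector \<Rightarrow>\<^sub>L real) \<Rightarrow>
     ('v \<Rightarrow> 'a \<Rightarrow>\<^sub>L real) \<Rightarrow> bool" where
  "symplectic \<Gamma> \<alpha> a \<longleftrightarrow>
     (\<forall>e\<in>arcs \<Gamma>. \<exists>m::int. m > 0 \<and> a (head \<Gamma> e) - a (tail \<Gamma> e) = real_of_int m *\<^sub>R \<alpha> e)"

section \<open>The virtual representation \<open>Q(f)\<close>\<close>

definition chi ::
    "('a::real_normed_vector \<Rightarrow> 'g) \<Rightarrow> ('v, 'e) pre_digraph \<Rightarrow> ('e \<Rightarrow> 'a \<Rightarrow>\<^sub>L real) \<Rightarrow>
     ('v \<Rightarrow> 'g \<Rightarrow> complex) \<Rightarrow> 'g \<Rightarrow> complex" where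
  "chi ex \<Gamma> \<alpha> f g =
     (\<Sum>p\<in>verts \<Gamma>. f p g * (\<Prod>e\<in>out_arcs \<Gamma> p. inverse (1 - weight_char ex (\<alpha> e) g)))"

text \<open>
  A virtual representation is identified with its character in \<open>R(G)\<close>. The formula for \<open>\<chi>(f)\<close> only
  makes sense off the zeros of its denominators; since all \<open>\<alpha>\<^sub>e\<close> are nonzero, what remains is open and
  dense in \<open>G\<close>, so at most one element of \<open>R(G)\<close> (a continuous function) has this character.
\<close>

definition is_Q ::
    "('a::real_normed_vector \<Rightarrow> 'g::{topological_space, group_add}) \<Rightarrow> ('v, 'e) pre_digraph \<Rightarrow>
     ('e \<Rightarrow> 'a \<Rightarrow>\<^sub>L real) \<Rightarrow> ('v \<Rightarrow> 'g \<Rightarrow> complex) \<Rightarrow> ('g \<Rightarrow> complex) \<Rightarrow> bool" where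
  "is_Q ex \<Gamma> \<alpha> f Q \<longleftrightarrow> Q \<in> rep_ring UNIV \<and>
     (\<forall>g. (\<forall>e\<in>arcs \<Gamma>. weight_char ex (\<alpha> e) g \<noteq> 1) \<longrightarrow> Q g = chi ex \<Gamma> \<alpha> f g)"

text \<open>
  \<open>m\<close> is the family of multiplicities of \<open>Q\<close>, i.e. \<open>Q\<close> is the finite sum of the \<open>m\<^sub>\<beta> e\<^bsup>2\<pi>i\<beta>\<^esup>\<close>; it is
  determined by \<open>Q\<close> because distinct characters are linearly independent.
\<close>

definition multiplicities ::
    "('a::real_normed_vector \<Rightarrow> 'g::ab_group_add) \<Rightarrow> ('g \<Rightarrow> complex) \<Rightarrow>
     (('a \<Rightarrow>\<^sub>L real) \<Rightarrow> int) \<Rightarrow> bool" where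
  "multiplicities ex Q m \<longleftrightarrow>
     finite {\<beta>. m \<beta> \<noteq> 0} \<and> {\<beta>. m \<beta> \<noteq> 0} \<subseteq> weight_lattice ex \<and>
     (\<forall>g. Q g = (\<Sum>\<beta>\<in>{\<beta>. m \<beta> \<noteq> 0}. of_int (m \<beta>) * weight_char ex \<beta> g))"

definition weight_of_Q ::
    "('a::real_normed_vector \<Rightarrow> 'g::{topological_space, ab_group_add}) \<Rightarrow> ('v, 'e) pre_digraph \<Rightarrow>
     ('e \<Rightarrow> 'a \<Rightarrow>\<^sub>L real) \<Rightarrow> ('v \<Rightarrow> 'g \<Rightarrow> complex) \<Rightarrow> ('a \<Rightarrow>\<^sub>L real) \<Rightarrow> bool" where
  "weight_of_Q ex \<Gamma> \<alpha> f \<beta> \<longleftrightarrow>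
     (\<exists>Q m. is_Q ex \<Gamma> \<alpha> f Q \<and> multiplicities ex Q m \<and> m \<beta> \<noteq> 0)"

end

theory Submission
  imports Defs "HOL-Complex_Analysis.Complex_Analysis" "HOL-Real_Asymp.Real_Asymp"
begin

text \<open>
  If \<open>\<beta>\<close> is outside the convex hull, then some \<open>v \<in> \<gg>\<close> satisfies \<open>\<alpha>\<^sub>p(v) < \<beta>(v)\<close> for all vertices \<open>p\<close>,
  and \<open>v\<close> may be perturbed so that no \<open>\<alpha>\<^sub>e(v)\<close> vanishes and the weights of \<open>Q(f)\<close> take distinct values
  at \<open>v\<close>. Along the one-parameter group of \<open>v\<close>, the fixed point formula for \<open>\<chi>(f)\<close> continues analytically
  to complex time. In the imaginary direction, \<open>Q(f)\<close> grows at least like \<open>e\<^bsup>s\<beta>(v)\<^esup>\<close>, while every factor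
  \<open>(1 - e\<^bsup>s\<alpha>\<^sub>e(v)\<^esup>)\<^sup>-\<^sup>1\<close> tends to 0 or 1, so that the other side is \<open>o(e\<^bsup>s\<beta>(v)\<^esup>)\<close>.
\<close>

section \<open>Separation and genericity\<close>

text \<open>The separating functional lives on the dual space, so it must be realised as evaluation
  at a vector of the Lie algebra. The values on the spanning set \<open>B\<close> embed the dual in
  a Euclidean space, where the nearest-point argument supplies that vector.\<close>

lemma separate_from_convex_hull:
  fixes S :: "('a::real_normed_vector \<Rightarrow>\<^sub>L real) set" and B :: "'a set"
  assumes "finite B" "span B = UNIV" "finite S" "\<beta> \<notin> convex hull S"
  obtains v where "\<And>s. s \<in> S \<Longrightarrow> blinfun_apply s v < blinfun_apply \<beta> v"
proof (cases "S = {}")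
  case True
  then show ?thesis using that by blast
next
  case False
  txt \<open>The nearest point of the hull, in the Euclidean structure given by the coordinates on \<open>B\<close>.\<close>
  define N where "N = (\<lambda>\<phi>::'a \<Rightarrow>\<^sub>L real. \<Sum>b\<in>B. (\<beta> b - \<phi> b)\<^sup>2)"
  have "continuous_on (convex hull S) N"
    unfolding N_def by (intro continuous_intros)
  moreover have "compact (convex hull S)" "convex hull S \<noteq> {}"
    using assms(3) False by (auto simp: finite_imp_compact_convex_hull)
  ultimately obtain \<phi> where \<phi>: "\<phi> \<in> convex hull S" and min: "\<And>\<psi>. \<psi> \<in> convex hull S \<Longrightarrow> N \<phi> \<le> N \<psi>"
    using continuous_attains_inf by meson
  define w where "w = (\<lambda>b::'a. \<beta> b - \<phi> b)"
  \<comment> \<open>With this choice, evaluation at \<open>v\<close> is the inner product with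
    \<open>w\<close>, the coordinate vector of \<open>\<beta> - \<phi>\<close>.\<close>
  define v where "v = (\<Sum>b\<in>B. w b *\<^sub>R b)"
  have apply_v: "blinfun_apply \<psi> v = (\<Sum>b\<in>B. w b * \<psi> b)" for \<psi> :: "'a \<Rightarrow>\<^sub>L real"
    by (simp add: v_def blinfun.sum_right blinfun.scaleR_right)
  have "\<exists>b\<in>B. w b \<noteq> 0"
  proof (rule ccontr)
    assume "\<not> (\<exists>b\<in>B. w b \<noteq> 0)"
    then have "\<beta> x = \<phi> x" for x
      using linear_eq_on[of \<beta> \<phi> x B] assms(2)
      by (auto simp: w_def blinfun.bounded_linear_right bounded_linear.linear)
    then have "\<beta> = \<phi>" by (simp add: blinfun_eqI)
    with \<phi> assms(4) show False by simp
  qed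
  then have pos: "0 < (\<Sum>b\<in>B. (w b)\<^sup>2)"
    using assms(1) by (metis (no_types, lifting) sum_pos2 zero_less_power2 zero_le_power2)
  show ?thesis
  proof (rule that)
    fix s assume s: "s \<in> S"
    define u where "u = (\<lambda>b::'a. s b - \<phi> b)"
    let ?W = "\<Sum>b\<in>B. (w b)\<^sup>2" and ?U = "\<Sum>b\<in>B. (u b)\<^sup>2" and ?I = "\<Sum>b\<in>B. w b * u b"
    have Unn: "?U \<ge> 0" by (simp add: sum_nonneg)
    \<comment> \<open>Moving from the minimiser \<open>\<phi>\<close> towards \<open>s\<close> by a
      fraction \<open>t\<close> stays in the hull and so cannot decrease \<open>N\<close>.\<close>
    have small: "2 * t * ?I \<le> t\<^sup>2 * ?U" if "0 \<le> t" "t \<le> 1" for t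
    proof -
      have "(1 - t) *\<^sub>R \<phi> + t *\<^sub>R s \<in> convex hull S"
        using convex_convex_hull[of S] \<phi> hull_inc[OF s] that
        by (simp add: convexD)
      from min[OF this]
      have "?W \<le> (\<Sum>b\<in>B. (w b - t * u b)\<^sup>2)"
        unfolding N_def
        by (simp add: w_def u_def plus_blinfun.rep_eq scaleR_blinfun.rep_eq left_diff_distrib
            right_diff_distrib diff_diff_eq add_diff_eq diff_add_eq add.commute)
      also have "\<dots> = ?W - 2 * t * ?I + t\<^sup>2 * ?U"
        by (simp add: power2_diff sum.distrib sum_subtractf sum_distrib_left algebra_simps
            power_mult_distrib)
      finally show ?thesis by simp
    qed
    have "?I \<le> 0"
    proof (rule ccontr)
      assume "\<not> ?I \<le> 0"
      then have I: "?I > 0" by simp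
      \<comment> \<open>A step so short that the quadratic term cannot offset the linear one. The
        summand 1 avoids division by zero when \<open>?U\<close> vanishes, and the minimum with 1
        keeps the point on the segment.\<close>
      define t where "t = min 1 (?I / (?U + 1))"
      have t: "0 < t" "t \<le> 1" "t \<le> ?I / (?U + 1)"
        using I Unn by (auto simp: t_def)
      then have tI: "t * (?U + 1) \<le> ?I"
        using Unn by (subst (asm) pos_le_divide_eq) auto
      have "2 * ?I \<le> t * ?U"
        using small[of t] t by (simp add: power2_eq_square)
      then show False using t(1) tI I by (simp add: distrib_left)
    qed
    moreover have "\<beta> v - s v = ?W - ?I"
      by (simp add: apply_v w_def u_def sum_subtractf[symmetric] power2_eq_square algebra_simps)
    ultimately show "s v < \<beta> v" using pos by simp
  qed
qed

text \<open>A nonzero functional is nonzero on an open dense set. The induction shrinks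
  \<open>U\<close> by one such set at a time, hence \<open>U\<close> is arbitrary in it.\<close>

lemma generic_vector:
  fixes F :: "('a::real_normed_vector \<Rightarrow>\<^sub>L real) set"
  assumes "finite F" "0 \<notin> F" "open U" "U \<noteq> {}"
  obtains v where "v \<in> U" "\<And>\<phi>. \<phi> \<in> F \<Longrightarrow> blinfun_apply \<phi> v \<noteq> 0"
proof -
  have "\<exists>v\<in>U. \<forall>\<phi>\<in>F. blinfun_apply \<phi> v \<noteq> 0"
    using assms
  proof (induction F arbitrary: U rule: finite_induct)
    case empty
    then show ?case by auto
  next
    case (insert \<phi> F)
    obtain w where w: "\<phi> w \<noteq> 0"
      using insert.prems by (metis blinfun_eqI insertI1 zero_blinfun.rep_eq)
    obtain u where u: "u \<in> U" using insert.prems by auto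
    let ?U' = "U \<inter> {x. \<phi> x \<noteq> 0}"
    have "open {x. \<phi> x \<noteq> 0}"
      by (intro open_Collect_neq continuous_intros)
    then have "open ?U'" using insert.prems by blast
    moreover have "?U' \<noteq> {}"
    proof (cases "\<phi> u = 0")
      case True
      \<comment> \<open>If \<open>\<phi>\<close> vanishes at \<open>u\<close>, a small displacement
        along \<open>w\<close> stays in \<open>U\<close> and gives \<open>\<phi>\<close> the nonzero
        value \<open>t * \<phi> w\<close>.\<close>
      have "((\<lambda>t. u + t *\<^sub>R w) \<longlongrightarrow> u + 0 *\<^sub>R w) (at (0::real))"
        by (intro tendsto_intros)
      then have "\<forall>\<^sub>F t in at (0::real). u + t *\<^sub>R w \<in> U"
        using insert.prems u by (intro topological_tendstoD[where l = "u + 0 *\<^sub>R w"]) auto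
      moreover have "\<forall>\<^sub>F t in at (0::real). t \<noteq> 0"
        by (simp add: eventually_at_filter)
      ultimately have "\<forall>\<^sub>F t in at (0::real). u + t *\<^sub>R w \<in> U \<and> t \<noteq> 0"
        by eventually_elim simp
      then obtain t :: real where "u + t *\<^sub>R w \<in> U" "t \<noteq> 0"
        using eventually_happens'[OF at_neq_bot] by blast
      then have "u + t *\<^sub>R w \<in> ?U'"
        using True w by (simp add: blinfun.add_right blinfun.scaleR_right)
      then show ?thesis by blast
    qed (use u in auto)
    moreover have "0 \<notin> F" using insert.prems by simp
    ultimately obtain v where "v \<in> ?U'" "\<forall>\<phi>\<in>F. blinfun_apply \<phi> v \<noteq> 0"
      using insert.IH[of ?U'] by blast
    then show ?case by auto
  qed
  then show ?thesis using that by blast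
qed

section \<open>Growth of exponential sums\<close>

lemma tendsto_exp_neg_at_top:
  assumes "(k::real) < 0"
  shows "((\<lambda>s. exp (of_real s * of_real k) :: complex) \<longlongrightarrow> 0) at_top"
proof -
  have "((\<lambda>s. exp (s * k)) \<longlongrightarrow> 0) at_top"
    using assms by real_asymp
  then have "((\<lambda>s. of_real (exp (s * k)) :: complex) \<longlongrightarrow> of_real 0) at_top"
    by (rule tendsto_of_real)
  then show ?thesis by (simp flip: exp_of_real)
qed

text \<open>The limit is 0 or 1 according to the sign of \<open>k\<close>. Its existence suffices,
  because the product of these factors is later multiplied by a term tending to 0.\<close>

lemma inverse_one_minus_exp_convergent:
  assumes "(k::real) \<noteq> 0"
  shows "\<exists>L. ((\<lambda>s. inverse (1 - exp (of_real s * of_real k)) :: complex) \<longlongrightarrow> L) at_top"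
proof -
  have "\<exists>L. ((\<lambda>s. inverse (1 - exp (s * k))) \<longlongrightarrow> L) at_top"
  proof (cases "k > 0")
    case True
    then have "((\<lambda>s. inverse (1 - exp (s * k))) \<longlongrightarrow> 0) at_top" by real_asymp
    then show ?thesis by blast
  next
    case False
    with assms have "k < 0" by simp
    then have "((\<lambda>s. inverse (1 - exp (s * k))) \<longlongrightarrow> 1) at_top" by real_asymp
    then show ?thesis by blast
  qed
  then obtain L where "((\<lambda>s. inverse (1 - exp (s * k))) \<longlongrightarrow> L) at_top" by blast
  then have "((\<lambda>s. of_real (inverse (1 - exp (s * k))) :: complex) \<longlongrightarrow> of_real L) at_top"
    by (rule tendsto_of_real)
  then show ?thesis by (auto simp flip: exp_of_real)
qed

text \<open>Multiplying by the product \<open>P\<close> of all denominators makes both sides entire.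
  They agree on a segment of the imaginary axis accumulating at 0, hence everywhere, and
  \<open>P\<close> can be divided out again wherever it is nonzero.\<close>

lemma exponential_identity_continuation:
  fixes m :: "'i \<Rightarrow> complex" and \<theta> :: "'i \<Rightarrow> real" and h :: "'v \<Rightarrow> real" and k :: "'e \<Rightarrow> real"
    and z :: complex
  assumes fin: "finite E" "\<And>p. p \<in> V \<Longrightarrow> D p \<subseteq> E"
    and k: "\<And>e. e \<in> E \<Longrightarrow> k e \<noteq> 0"
    and eq: "\<And>t. (\<And>e. e \<in> E \<Longrightarrow> cis (t * k e) \<noteq> 1) \<Longrightarrow>
      (\<Sum>\<mu>\<in>M. m \<mu> * cis (t * \<theta> \<mu>)) =
      (\<Sum>p\<in>V. cis (t * h p) * (\<Prod>e\<in>D p. inverse (1 - cis (t * k e))))"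
    and z: "\<And>e. e \<in> E \<Longrightarrow> exp (z * k e) \<noteq> 1"
  shows "(\<Sum>\<mu>\<in>M. m \<mu> * exp (z * \<theta> \<mu>)) =
      (\<Sum>p\<in>V. exp (z * h p) * (\<Prod>e\<in>D p. inverse (1 - exp (z * k e))))"
proof -
  define P where "P = (\<lambda>z::complex. \<Prod>e\<in>E. 1 - exp (z * k e))"
  define L where "L = (\<lambda>z::complex. \<Sum>\<mu>\<in>M. m \<mu> * exp (z * \<theta> \<mu>))"
  define R where
    "R = (\<lambda>z::complex. \<Sum>p\<in>V. exp (z * h p) * (\<Prod>e\<in>D p. inverse (1 - exp (z * k e))))"
  define R' where
    "R' = (\<lambda>z::complex. \<Sum>p\<in>V. exp (z * h p) * (\<Prod>e\<in>E - D p. 1 - exp (z * k e)))"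
  have clear: "R z * P z = R' z" if "\<And>e. e \<in> E \<Longrightarrow> exp (z * k e) \<noteq> 1" for z :: complex
  proof -
    have "(\<Prod>e\<in>D p. inverse (1 - exp (z * k e))) * P z = (\<Prod>e\<in>E - D p. 1 - exp (z * k e))"
      if "p \<in> V" for p
    proof -
      have "P z = (\<Prod>e\<in>E - D p. 1 - exp (z * k e)) * (\<Prod>e\<in>D p. 1 - exp (z * k e))"
        unfolding P_def using fin that by (intro prod.subset_diff) auto
      moreover have "(\<Prod>e\<in>D p. 1 - exp (z * k e)) \<noteq> 0"
        using fin(2)[OF \<open>p \<in> V\<close>] finite_subset[OF fin(2)[OF \<open>p \<in> V\<close>] fin(1)]
          \<open>\<And>e. e \<in> E \<Longrightarrow> exp (z * k e) \<noteq> 1\<close>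
        by auto
      moreover have "(\<Prod>e\<in>D p. inverse (1 - exp (z * k e))) = inverse (\<Prod>e\<in>D p. 1 - exp (z * k e))"
        using prod_inversef[of "\<lambda>e. 1 - exp (z * k e)" "D p"] by (simp add: comp_def)
      ultimately show ?thesis by simp
    qed
    then show ?thesis
      unfolding R_def R'_def by (simp add: sum_distrib_right mult.assoc)
  qed
  \<comment> \<open>For \<open>0 < t < 1/K\<close> every \<open>\<bar>t * k e\<bar>\<close> lies
    strictly between 0 and 1, hence below 2 pi, so no denominator vanishes. Inserting 1 keeps
    \<open>K\<close> positive and the maximum defined when \<open>E\<close> is empty.\<close>
  define K where "K = Max (insert 1 ((\<lambda>e. \<bar>k e\<bar>) ` E))"
  have "1 \<le> K" "\<And>e. e \<in> E \<Longrightarrow> \<bar>k e\<bar> \<le> K"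
    unfolding K_def using fin(1) by (auto intro!: Max_ge)
  then have K: "K > 0" "\<And>e. e \<in> E \<Longrightarrow> \<bar>k e\<bar> \<le> K"
    by auto
  have entire: "(\<lambda>z. L z * P z - R' z) holomorphic_on UNIV"
    unfolding L_def P_def R'_def by (intro holomorphic_intros)
  have "L z * P z - R' z = 0"
  proof (rule analytic_continuation[OF entire, of "(\<lambda>t. \<i> * of_real t) ` {0<..<1/K}" 0])
    show "0 islimpt (\<lambda>t. \<i> * complex_of_real t) ` {0<..<1/K}"
      unfolding islimpt_approachable
    proof (intro allI impI)
      fix \<epsilon> :: real assume "\<epsilon> > 0"
      then obtain t where "0 < t" "t < min \<epsilon> (1/K)"
        using K(1) dense[of 0 "min \<epsilon> (1/K)"] by auto
      then show "\<exists>x'\<in>(\<lambda>t. \<i> * complex_of_real t) ` {0<..<1/K}. x' \<noteq> 0 \<and> dist x' 0 < \<epsilon>"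
        by (intro bexI[of _ "\<i> * of_real t"]) (auto simp: norm_mult)
    qed
  next
    fix w assume "w \<in> (\<lambda>t. \<i> * complex_of_real t) ` {0<..<1/K}"
    then obtain t where t: "0 < t" "t < 1/K" and w: "w = \<i> * of_real t" by auto
    have cis: "exp (w * of_real x) = cis (t * x)" for x
      by (simp add: w cis_conv_exp mult.assoc)
    have nz: "cis (t * k e) \<noteq> 1" if e: "e \<in> E" for e
    proof
      assume "cis (t * k e) = 1"
      then have "cos (t * k e) = 1" by (metis cis.simps(1) one_complex.simps(1))
      have "\<bar>t * k e\<bar> < 1"
      proof -
        have "t * \<bar>k e\<bar> \<le> t * K" using t K(2)[OF e] by (intro mult_left_mono) auto
        also have "\<dots> < 1" using t K(1) by (simp add: field_simps)
        finally show ?thesis using t by (simp add: abs_mult)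
      qed
      then have "t * k e = 0"
      proof -
        obtain j :: int where j: "t * k e = of_int j * 2 * pi"
          using \<open>cos (t * k e) = 1\<close> cos_one_2pi_int by blast
        with \<open>\<bar>t * k e\<bar> < 1\<close> have "\<bar>real_of_int j\<bar> * (2 * pi) < 1"
          by (simp add: abs_mult)
        also have "1 < 1 * (2 * pi)" using pi_ge_two by simp
        finally have "\<bar>real_of_int j\<bar> < 1"
          by (rule mult_right_less_imp_less) simp
        then have "j = 0" by linarith
        with j show ?thesis by simp
      qed
      then show False using t k[OF e] by simp
    qed
    then have "L w = R w"
      using eq[of t] by (simp add: L_def R_def cis)
    then show "L w * P w - R' w = 0"
      using clear[of w] nz by (simp add: cis)
  qed auto
  then have "(L z - R z) * P z = 0"
    using clear[of z] z by (simp add: algebra_simps)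
  moreover have "P z \<noteq> 0"
    using z fin by (auto simp: P_def)
  ultimately show ?thesis by (simp add: L_def R_def)
qed

text \<open>Evaluate the continued identity at real \<open>z = s\<close> and let \<open>s\<close>
  grow. After division by the exponential of the top frequency \<open>\<theta> \<kappa>\<close>, the
  left side tends to \<open>m \<kappa>\<close>, which is nonzero, whereas the right side would tend
  to 0 if every \<open>h p\<close> were below \<open>\<theta> \<nu>\<close>.\<close>

lemma exponential_identity_growth:
  fixes m :: "'i \<Rightarrow> complex" and \<theta> :: "'i \<Rightarrow> real" and h :: "'v \<Rightarrow> real" and k :: "'e \<Rightarrow> real"
  assumes fin: "finite E" "\<And>p. p \<in> V \<Longrightarrow> D p \<subseteq> E"
    and k: "\<And>e. e \<in> E \<Longrightarrow> k e \<noteq> 0"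
    and M: "finite M" "inj_on \<theta> M" "\<And>\<mu>. \<mu> \<in> M \<Longrightarrow> m \<mu> \<noteq> 0"
    and eq: "\<And>t. (\<And>e. e \<in> E \<Longrightarrow> cis (t * k e) \<noteq> 1) \<Longrightarrow>
      (\<Sum>\<mu>\<in>M. m \<mu> * cis (t * \<theta> \<mu>)) =
      (\<Sum>p\<in>V. cis (t * h p) * (\<Prod>e\<in>D p. inverse (1 - cis (t * k e))))"
    and \<nu>: "\<nu> \<in> M"
  shows "\<exists>p\<in>V. \<theta> \<nu> \<le> h p"
proof (rule ccontr)
  assume "\<not> (\<exists>p\<in>V. \<theta> \<nu> \<le> h p)"
  then have h: "h p < \<theta> \<nu>" if "p \<in> V" for p using that by force
  obtain \<kappa> where \<kappa>: "\<kappa> \<in> M" "\<And>\<mu>. \<mu> \<in> M \<Longrightarrow> \<theta> \<mu> \<le> \<theta> \<kappa>"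
  proof -
    have "Max (\<theta> ` M) \<in> \<theta> ` M" using M(1) \<nu> by (intro Max_in) auto
    then obtain \<kappa> where "\<kappa> \<in> M" "\<theta> \<kappa> = Max (\<theta> ` M)" by auto
    then show ?thesis using that M(1) by simp
  qed
  define L where "L = (\<lambda>s::real. \<Sum>\<mu>\<in>M. m \<mu> * exp (of_real s * of_real (\<theta> \<mu> - \<theta> \<kappa>)))"
  define R where "R = (\<lambda>s::real. \<Sum>p\<in>V. exp (of_real s * of_real (h p - \<theta> \<kappa>)) *
    (\<Prod>e\<in>D p. inverse (1 - exp (complex_of_real s * of_real (k e)))))"
  have "(L \<longlongrightarrow> (\<Sum>\<mu>\<in>M. m \<mu> * (if \<mu> = \<kappa> then 1 else 0))) at_top"
    unfolding L_def
  proof (intro tendsto_sum tendsto_mult tendsto_const)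
    fix \<mu> assume \<mu>: "\<mu> \<in> M"
    show "((\<lambda>s. exp (of_real s * of_real (\<theta> \<mu> - \<theta> \<kappa>)) :: complex)
        \<longlongrightarrow> (if \<mu> = \<kappa> then 1 else 0)) at_top"
    proof (cases "\<mu> = \<kappa>")
      case False
      \<comment> \<open>Injectivity of \<open>\<theta>\<close> makes the top frequency unique, so no
        other term can cancel \<open>m \<kappa>\<close> in the limit.\<close>
      then have "\<theta> \<mu> - \<theta> \<kappa> < 0"
        using \<kappa> \<mu> M(2) by (metis diff_less_0_iff_less inj_onD order_less_le)
      then show ?thesis using False tendsto_exp_neg_at_top[of "\<theta> \<mu> - \<theta> \<kappa>"] by auto
    qed simp
  qed
  then have L: "(L \<longlongrightarrow> m \<kappa>) at_top"
    using M(1) \<kappa>(1) by (simp add: if_distrib cong: if_cong)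
  have "(R \<longlongrightarrow> (\<Sum>p\<in>V. 0)) at_top"
    unfolding R_def
  proof (rule tendsto_sum)
    fix p assume p: "p \<in> V"
    have "\<exists>l. \<forall>e\<in>D p. ((\<lambda>s. inverse (1 - exp (complex_of_real s * of_real (k e)))) \<longlongrightarrow> l e) at_top"
      using inverse_one_minus_exp_convergent k fin(2)[OF p] by (intro bchoice) blast
    then obtain l where
      "\<And>e. e \<in> D p \<Longrightarrow> ((\<lambda>s. inverse (1 - exp (complex_of_real s * of_real (k e)))) \<longlongrightarrow> l e) at_top"
      by blast
    then have "((\<lambda>s. \<Prod>e\<in>D p. inverse (1 - exp (complex_of_real s * of_real (k e))))
        \<longlongrightarrow> (\<Prod>e\<in>D p. l e)) at_top"
      by (intro tendsto_prod)
    moreover have "h p - \<theta> \<kappa> < 0" using h[OF p] \<kappa>(2)[OF \<nu>] by simp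
    ultimately show "((\<lambda>s. exp (of_real s * of_real (h p - \<theta> \<kappa>)) *
        (\<Prod>e\<in>D p. inverse (1 - exp (complex_of_real s * of_real (k e))))) \<longlongrightarrow> 0) at_top"
      using tendsto_mult[OF tendsto_exp_neg_at_top] by fastforce
  qed
  then have R: "(R \<longlongrightarrow> 0) at_top" by simp
  have "L s = R s" if s: "s > 0" for s
  proof -
    \<comment> \<open>The normalising factor common to both sides: \<open>L\<close> and
      \<open>R\<close> are \<open>c\<close> times the two sides of the identity at
      \<open>z = s\<close>.\<close>
    define c where "c = exp (- complex_of_real (s * \<theta> \<kappa>))"
    have split: "exp (of_real s * of_real (x - \<theta> \<kappa>)) = c * exp (of_real s * complex_of_real x)" for x
      by (simp add: c_def algebra_simps flip: exp_add)
    have L_eq: "L s = c * (\<Sum>\<mu>\<in>M. m \<mu> * exp (of_real s * of_real (\<theta> \<mu>)))"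
      unfolding L_def split sum_distrib_left by (simp only: mult_ac)
    have R_eq: "R s = c * (\<Sum>p\<in>V. exp (of_real s * of_real (h p)) *
        (\<Prod>e\<in>D p. inverse (1 - exp (complex_of_real s * of_real (k e)))))"
      unfolding R_def split sum_distrib_left by (simp only: mult_ac)
    have "exp (complex_of_real s * of_real (k e)) \<noteq> 1" if "e \<in> E" for e
    proof -
      have "exp (s * k e) \<noteq> 1" using s k[OF that] by simp
      then show ?thesis by (metis exp_of_real of_real_eq_1_iff of_real_mult)
    qed
    from exponential_identity_continuation[OF fin k eq this] show ?thesis
      unfolding L_eq R_eq by simp
  qed
  then have "\<forall>\<^sub>F s in at_top. L s = R s"
    by (intro eventually_mono[OF eventually_gt_at_top[of 0]])
  with L have "(R \<longlongrightarrow> m \<kappa>) at_top" by (metis tendsto_cong)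
  with R have "m \<kappa> = 0" by (metis tendsto_unique trivial_limit_at_top_linorder)
  with M(3) \<kappa>(1) show False by blast
qed

section \<open>Weights of \<open>Q(f)\<close>\<close>

text \<open>The preimage picked by \<open>inv_into\<close> differs from \<open>x\<close> by a kernel
  element, on which a lattice weight is an integer; \<open>cis\<close> does not see this integer
  after scaling by 2 pi.\<close>

lemma (in torus) weight_char_ex:
  assumes "\<alpha> \<in> weight_lattice ex"
  shows "weight_char ex \<alpha> (ex x) = cis (2 * pi * blinfun_apply \<alpha> x)"
proof -
  define y where "y = inv_into UNIV ex (ex x)"
  have "ex y = ex x" unfolding y_def by (simp add: f_inv_into_f)
  then have "ex (y - x) = 0" using ex_add[of "y - x" x] by simp
  then obtain j where "\<alpha> (y - x) = of_int j"
    using assms by (auto simp: weight_lattice_def exp_kernel_def Ints_def)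
  then have "\<alpha> y = \<alpha> x + of_int j" by (simp add: blinfun.diff_right)
  then have "cis (2 * pi * \<alpha> y) = cis (2 * pi * \<alpha> x) * cis (2 * pi * of_int j)"
    by (simp add: cis_mult algebra_simps)
  then show ?thesis by (simp add: weight_char_def y_def cis_multiple_2pi)
qed

theorem theorem1p2:
  fixes n d :: nat
    and ex :: "'a::real_normed_vector \<Rightarrow> 'g::{topological_ab_group_add, t2_space}"
    and \<Gamma> :: "('v, 'e) pre_digraph" and arev :: "'e \<Rightarrow> 'e"
    and \<rho> :: "'e \<Rightarrow> 'g \<Rightarrow> complex mat"
    and \<alpha> :: "'e \<Rightarrow> 'a \<Rightarrow>\<^sub>L real"
    and \<tau> :: "'v \<Rightarrow> 'g \<Rightarrow> complex mat"
    and f :: "'v \<Rightarrow> 'g \<Rightarrow> complex"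
    and a :: "'v \<Rightarrow> 'a \<Rightarrow>\<^sub>L real"
    and \<beta> :: "'a \<Rightarrow>\<^sub>L real"
  assumes "gkm_action n ex \<Gamma> arev d \<rho> \<alpha> \<tau>"
    and "f \<in> K_ring ex \<Gamma> \<alpha>"
    and "\<And>p. p \<in> verts \<Gamma> \<Longrightarrow> a p \<in> weight_lattice ex \<and> f p = weight_char ex (a p)"
    and "symplectic \<Gamma> \<alpha> a"
    and "\<beta> \<in> weight_lattice ex"
    and "weight_of_Q ex \<Gamma> \<alpha> f \<beta>"
  shows "\<beta> \<in> convex hull (a ` verts \<Gamma>)"
proof (rule ccontr)
  assume notin: "\<beta> \<notin> convex hull (a ` verts \<Gamma>)"
  interpret gkm_action n ex \<Gamma> arev d \<rho> \<alpha> \<tau> by fact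
  obtain Q m where Q: "is_Q ex \<Gamma> \<alpha> f Q" and mult: "multiplicities ex Q m" and m\<beta>: "m \<beta> \<noteq> 0"
    using assms(6) by (auto simp: weight_of_Q_def)
  define M where "M = {\<mu>. m \<mu> \<noteq> 0}"
  have M: "finite M" "M \<subseteq> weight_lattice ex"
    and Q_sum: "\<And>g. Q g = (\<Sum>\<mu>\<in>M. of_int (m \<mu>) * weight_char ex \<mu> g)"
    using mult by (auto simp: multiplicities_def M_def)
  obtain B where B: "finite B" "span B = (UNIV :: 'a set)" using lattice by blast
  \<comment> \<open>All vectors separating \<open>\<beta>\<close> from the vertex weights. As
    finitely many strict inequalities they form an open set, which leaves room for a generic
    choice.\<close>
  define U where "U = (\<Inter>p\<in>verts \<Gamma>. {x. blinfun_apply (a p) x < blinfun_apply \<beta> x})"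
  have "open U"
    unfolding U_def by (intro open_INT ballI open_Collect_less continuous_intros) simp
  moreover have "U \<noteq> {}"
  proof -
    obtain x where "\<And>s. s \<in> a ` verts \<Gamma> \<Longrightarrow> blinfun_apply s x < blinfun_apply \<beta> x"
      using separate_from_convex_hull[OF B finite_imageI[OF finite_verts] notin] by blast
    then have "x \<in> U" by (simp add: U_def)
    then show ?thesis by blast
  qed
  \<comment> \<open>Nonvanishing at \<open>v\<close> is required of the edge weights, so that the
    denominators are nontrivial along the one-parameter group, and of differences of distinct
    weights in \<open>M\<close>, so that their frequencies are distinct.\<close>
  moreover define F where "F = \<alpha> ` arcs \<Gamma> \<union> ((\<lambda>(\<mu>, \<mu>'). \<mu> - \<mu>') ` (M \<times> M) - {0})"
  have "finite F" "0 \<notin> F"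
    using M(1) weight_nonzero by (auto simp: F_def)
  ultimately obtain v where v: "v \<in> U" "\<And>\<phi>. \<phi> \<in> F \<Longrightarrow> blinfun_apply \<phi> v \<noteq> 0"
    using generic_vector by metis
  have inj: "inj_on (\<lambda>\<mu>. 2 * pi * blinfun_apply \<mu> v) M"
  proof (rule inj_onI, rule ccontr)
    fix \<mu> \<mu>' assume "\<mu> \<in> M" "\<mu>' \<in> M" "\<mu> \<noteq> \<mu>'"
      "2 * pi * blinfun_apply \<mu> v = 2 * pi * blinfun_apply \<mu>' v"
    then have "\<mu> - \<mu>' \<in> F" "(\<mu> - \<mu>') v = 0"
      by (force simp: F_def, simp add: blinfun.diff_left)
    with v show False by blast
  qed
  \<comment> \<open>Along the one-parameter group of \<open>v\<close>, each character becomes a pure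
    oscillation in \<open>t\<close> of frequency \<open>2 * pi * \<mu> v\<close>.\<close>
  have char: "weight_char ex \<mu> (ex (t *\<^sub>R v)) = cis (t * (2 * pi * blinfun_apply \<mu> v))"
    if "\<mu> \<in> weight_lattice ex" for \<mu> t
    using weight_char_ex[OF that] by (simp add: blinfun.scaleR_right mult.left_commute mult.commute)
  have "\<exists>p\<in>verts \<Gamma>. 2 * pi * blinfun_apply \<beta> v \<le> 2 * pi * blinfun_apply (a p) v"
  proof (rule exponential_identity_growth[where E = "arcs \<Gamma>" and D = "out_arcs \<Gamma>" and M = M
        and k = "\<lambda>e. 2 * pi * blinfun_apply (\<alpha> e) v" and m = "\<lambda>\<mu>. of_int (m \<mu>)"
        and \<theta> = "\<lambda>\<mu>. 2 * pi * blinfun_apply \<mu> v"])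
    fix t assume *: "\<And>e. e \<in> arcs \<Gamma> \<Longrightarrow> cis (t * (2 * pi * blinfun_apply (\<alpha> e) v)) \<noteq> 1"
    let ?g = "ex (t *\<^sub>R v)"
    \<comment> \<open>The condition on \<open>t\<close> says exactly that \<open>?g\<close> avoids
      the zeros of the denominators, which is where \<open>is_Q\<close> equates \<open>Q\<close>
      with the fixed point formula.\<close>
    have "Q ?g = chi ex \<Gamma> \<alpha> f ?g"
      using Q * edge_weight by (simp add: is_Q_def char)
    moreover have "Q ?g = (\<Sum>\<mu>\<in>M. of_int (m \<mu>) * cis (t * (2 * pi * blinfun_apply \<mu> v)))"
      unfolding Q_sum using M(2) by (intro sum.cong) (auto simp: char)
    moreover have "chi ex \<Gamma> \<alpha> f ?g = (\<Sum>p\<in>verts \<Gamma>. cis (t * (2 * pi * blinfun_apply (a p) v)) *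
        (\<Prod>e\<in>out_arcs \<Gamma> p. inverse (1 - cis (t * (2 * pi * blinfun_apply (\<alpha> e) v)))))"
      unfolding chi_def using assms(3) edge_weight
      by (intro sum.cong arg_cong2[where f = times] prod.cong) (auto simp: char)
    ultimately show "(\<Sum>\<mu>\<in>M. of_int (m \<mu>) * cis (t * (2 * pi * blinfun_apply \<mu> v))) =
      (\<Sum>p\<in>verts \<Gamma>. cis (t * (2 * pi * blinfun_apply (a p) v)) *
        (\<Prod>e\<in>out_arcs \<Gamma> p. inverse (1 - cis (t * (2 * pi * blinfun_apply (\<alpha> e) v)))))"
      by simp
  qed (use M(1) inj m\<beta> v(2) in \<open>auto simp: M_def F_def\<close>)
  with v(1) show False by (force simp: U_def)
qed

end
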